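(* Let $(r_S,r_T,\alpha,\beta)$ be a matched product system of solutions in which $r_S$ (on a set $S$) and $r_T$ (on a set $T$) are left non-degenerate. Then the matched product solution $r:=r_S\bowtie r_T$ on $S\times T$ is left non-degenerate and its structure shelf operation is $$(a,u)\triangleright_{r}(b,v)=\big(a\triangleright_{r_S}b,\ u\triangleright_{r_T}v\big)$$ for all $a,b\in S$ and $u,v\in T$.
   Context: Solutions. A (set-theoretical) solution on a set $X$ is a map $r:X\times X\to X\times X$ with $(r\times\mathrm{id}_X)(\mathrm{id}_X\times r)(r\times\mathrm{id}_X)=(\mathrm{id}_X\times r)(r\times\mathrm{id}_X)(\mathrm{id}_X\times r)$. Write $r(x,y)=(\lambda_x(y),\rho_y(x))$. The solution $r$ is left non-degenerate if every $\lambda_x$ is bijective. Structure shelf. If $r$ is a left non-degenerate solution on $X$, its structure shelf is $X$ with the operation $x\triangleright_r y:=\lambda_x\big(\rho_{\lambda_y^{-1}(x)}(y)\big)$ (known to be left self-distributive). $\mathrm{Sym}(X)$ is the group of bijections $X\to X$; juxtaposition of maps is composition, $fg=f\circ g$. Matched product systems. Given solutions $r_S$ on $S$ and $r_T$ on $T$ (components of both written $\lambda,\rho$, with $a,b\in S$ and $u,v\in T$) and maps $\alpha:T\to\mathrm{Sym}(S)$, $\beta:S\to\mathrm{Sym}(T)$, with $\alpha_u:=\alpha(u)$, $\beta_a:=\beta(a)$, the quadruple $(r_S,r_T,\alpha,\beta)$ is a matched product system of solutions if for all $a,b\in S$, $u,v\in T$: (s1) $\alpha_u\alpha_v=\alpha_{\lambda_u(v)}\alpha_{\rho_v(u)}$;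 (s2) $\beta_a\beta_b=\beta_{\lambda_a(b)}\beta_{\rho_b(a)}$; (s3) $\rho_{\alpha_u^{-1}(b)}\big(\alpha^{-1}_{\beta_a(u)}(a)\big)=\alpha^{-1}_{\beta_{\rho_b(a)}\beta_b^{-1}(u)}\big(\rho_b(a)\big)$; (s4) $\rho_{\beta_a^{-1}(v)}\big(\beta^{-1}_{\alpha_u(a)}(u)\big)=\beta^{-1}_{\alpha_{\rho_v(u)}\alpha_v^{-1}(a)}\big(\rho_v(u)\big)$; (s5) $\lambda_a\alpha_{\beta_a^{-1}(u)}=\alpha_u\lambda_{\alpha_u^{-1}(a)}$; (s6) $\lambda_u\beta_{\alpha_u^{-1}(a)}=\beta_a\lambda_{\beta_a^{-1}(u)}$. Matched product. For a matched product system, the matched product solution $r_S\bowtie r_T$ is the map on $(S\times T)\times(S\times T)$ (known to be a solution on $S\times T$) $$\big((a,u),(b,v)\big)\mapsto\Big(\big(A,U\big),\ \big(\alpha^{-1}_{\overline U}(\rho_{\alpha_{\bar u}(b)}(a)),\ \beta^{-1}_{\overline A}(\rho_{\beta_{\bar a}(v)}(u))\big)\Big),$$ where $\bar a=\alpha_u^{-1}(a)$, $\bar u=\beta_a^{-1}(u)$, $A=\alpha_u(\lambda_{\bar a}(b))$, $U=\beta_a(\lambda_{\bar u}(v))$, $\overline A=\alpha_U^{-1}(A)$, $\overline U=\beta_A^{-1}(U)$. *)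

theory Defs
  imports Main
begin

text \<open>
  Solutions live on a type playing the role of the underlying set. Writing
  \<open>r (x, y) = (\<lambda>\<^sub>x y, \<rho>\<^sub>y x)\<close>, we have \<open>lam r x = \<lambda>\<^sub>x\<close> and \<open>rho r y = \<rho>\<^sub>y\<close>; note
  that \<open>rho\<close> takes the \<^emph>\<open>second\<close> entry of the pair as its index.
\<close>

definition lam :: "('x \<times> 'x \<Rightarrow> 'x \<times> 'x) \<Rightarrow> 'x \<Rightarrow> 'x \<Rightarrow> 'x" where
  "lam r x y = fst (r (x, y))"

definition rho :: "('x \<times> 'x \<Rightarrow> 'x \<times> 'x) \<Rightarrow> 'x \<Rightarrow> 'x \<Rightarrow> 'x" where
  "rho r y x = snd (r (x, y))"

text \<open>\<open>r \<times> id\<close> and \<open>id \<times> r\<close> acting on triples \<open>(x, y, z) = (x, (y, z))\<close>.\<close>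

definition on_first_two :: "('x \<times> 'x \<Rightarrow> 'x \<times> 'x) \<Rightarrow> 'x \<times> 'x \<times> 'x \<Rightarrow> 'x \<times> 'x \<times> 'x" where
  "on_first_two r = (\<lambda>(x, y, z). (fst (r (x, y)), snd (r (x, y)), z))"

definition on_last_two :: "('x \<times> 'x \<Rightarrow> 'x \<times> 'x) \<Rightarrow> 'x \<times> 'x \<times> 'x \<Rightarrow> 'x \<times> 'x \<times> 'x" where
  "on_last_two r = map_prod id r"

definition ybe_solution :: "('x \<times> 'x \<Rightarrow> 'x \<times> 'x) \<Rightarrow> bool" where
  "ybe_solution r \<longleftrightarrow>
     on_first_two r \<circ> on_last_two r \<circ> on_first_two r =
     on_last_two r \<circ> on_first_two r \<circ> on_last_two r"

definition left_nondegenerate :: "('x \<times> 'x \<Rightarrow> 'x \<times> 'x) \<Rightarrow> bool" where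
  "left_nondegenerate r \<longleftrightarrow> (\<forall>x. bij (lam r x))"

text \<open>Only meaningful for left non-degenerate \<open>r\<close>, where \<open>inv (lam r y)\<close> is a true inverse.\<close>

definition structure_shelf :: "('x \<times> 'x \<Rightarrow> 'x \<times> 'x) \<Rightarrow> 'x \<Rightarrow> 'x \<Rightarrow> 'x" where
  "structure_shelf r x y = lam r x (rho r (inv (lam r y) x) y)"

definition matched_product_system ::
  "('s \<times> 's \<Rightarrow> 's \<times> 's) \<Rightarrow> ('t \<times> 't \<Rightarrow> 't \<times> 't) \<Rightarrow>
   ('t \<Rightarrow> 's \<Rightarrow> 's) \<Rightarrow> ('s \<Rightarrow> 't \<Rightarrow> 't) \<Rightarrow> bool" where
  "matched_product_system rS rT \<alpha> \<beta> \<longleftrightarrow>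
     ybe_solution rS \<and> ybe_solution rT \<and>
     (\<forall>u. bij (\<alpha> u)) \<and> (\<forall>a. bij (\<beta> a)) \<and>
     (\<forall>u v. \<alpha> u \<circ> \<alpha> v = \<alpha> (lam rT u v) \<circ> \<alpha> (rho rT v u)) \<and>
     (\<forall>a b. \<beta> a \<circ> \<beta> b = \<beta> (lam rS a b) \<circ> \<beta> (rho rS b a)) \<and>
     (\<forall>a b u. rho rS (inv (\<alpha> u) b) (inv (\<alpha> (\<beta> a u)) a) =
        inv (\<alpha> (\<beta> (rho rS b a) (inv (\<beta> b) u))) (rho rS b a)) \<and>
     (\<forall>u v a. rho rT (inv (\<beta> a) v) (inv (\<beta> (\<alpha> u a)) u) =
        inv (\<beta> (\<alpha> (rho rT v u) (inv (\<alpha> v) a))) (rho rT v u)) \<and>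
     (\<forall>a u. lam rS a \<circ> \<alpha> (inv (\<beta> a) u) = \<alpha> u \<circ> lam rS (inv (\<alpha> u) a)) \<and>
     (\<forall>a u. lam rT u \<circ> \<beta> (inv (\<alpha> u) a) = \<beta> a \<circ> lam rT (inv (\<beta> a) u))"

definition matched_product ::
  "('s \<times> 's \<Rightarrow> 's \<times> 's) \<Rightarrow> ('t \<times> 't \<Rightarrow> 't \<times> 't) \<Rightarrow>
   ('t \<Rightarrow> 's \<Rightarrow> 's) \<Rightarrow> ('s \<Rightarrow> 't \<Rightarrow> 't) \<Rightarrow>
   ('s \<times> 't) \<times> ('s \<times> 't) \<Rightarrow> ('s \<times> 't) \<times> ('s \<times> 't)" where
  "matched_product rS rT \<alpha> \<beta> = (\<lambda>((a, u), (b, v)).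
     (let a' = inv (\<alpha> u) a;
          u' = inv (\<beta> a) u;
          A = \<alpha> u (lam rS a' b);
          U = \<beta> a (lam rT u' v);
          A' = inv (\<alpha> U) A;
          U' = inv (\<beta> A) U
      in ((A, U),
          (inv (\<alpha> U') (rho rS (\<alpha> u' b) a),
           inv (\<beta> A') (rho rT (\<beta> a' v) u)))))"

end

theory Submission
  imports Defs
begin

text \<open>
  The left action of a pair splits. By definition \<open>\<lambda>\<close> of the matched product at
  \<open>(a, u)\<close> acts on \<open>S\<close> by \<open>\<alpha>\<^sub>u \<lambda>\<^sub>c\<close> with \<open>c = \<alpha>\<^sub>u\<^sup>-\<^sup>1(a)\<close>. The compatibility axiom between
  \<open>\<lambda>\<close> and \<open>\<alpha>\<close> moves the twist to the other side: this map equals \<open>\<lambda>\<^sub>a \<alpha>\<^sub>w\<close> with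
  \<open>w = \<beta>\<^sub>a\<^sup>-\<^sup>1(u)\<close>. The action on \<open>T\<close> is symmetric. So \<open>\<lambda>\<close> of the matched product is a
  product of two bijections, which is left non-degeneracy.

  The rewritten form also makes every twist cancel in the shelf. Let \<open>(c, w)\<close> be the
  preimage of \<open>(a, u)\<close> under \<open>\<lambda>\<close> at \<open>(b, v)\<close>, and put \<open>v' = \<beta>\<^sub>b\<^sup>-\<^sup>1(v)\<close>. Then
  \<open>\<lambda>\<^sub>b(\<alpha>\<^bsub>v'\<^esub>(c)) = a\<close>, so the index \<open>\<alpha>\<^bsub>v'\<^esub>(c)\<close> at which the matched product evaluates
  \<open>\<rho>\<close> of \<open>S\<close> is exactly \<open>\<lambda>\<^sub>b\<^sup>-\<^sup>1(a)\<close>. The result is then twisted by \<open>\<alpha>\<^sup>-\<^sup>1\<close> at an index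
  computed from the output \<open>(a, u)\<close>, namely \<open>\<beta>\<^sub>a\<^sup>-\<^sup>1(u)\<close>. The map \<open>\<lambda>\<close> at \<open>(a, u)\<close>,
  applied next, begins with \<open>\<alpha>\<close> at this same index. What remains on \<open>S\<close> is
  \<open>\<lambda>\<^sub>a(\<rho>\<^sub>x(b))\<close> with \<open>x = \<lambda>\<^sub>b\<^sup>-\<^sup>1(a)\<close>, the shelf operation of \<open>S\<close>.
\<close>

text \<open>
  In this form the maps of \<open>rS\<close> and \<open>rT\<close> are indexed by \<open>a\<close> and \<open>u\<close> themselves and are
  applied last, as in the structure shelves of \<open>rS\<close> and \<open>rT\<close>.
\<close>

lemma lam_matched_product:
  assumes "matched_product_system rS rT \<alpha> \<beta>"
  shows "lam (matched_product rS rT \<alpha> \<beta>) (a, u) =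
    map_prod (lam rS a \<circ> \<alpha> (inv (\<beta> a) u)) (lam rT u \<circ> \<beta> (inv (\<alpha> u) a))"
proof -
  have s5: "lam rS a \<circ> \<alpha> (inv (\<beta> a) u) = \<alpha> u \<circ> lam rS (inv (\<alpha> u) a)"
    and s6: "lam rT u \<circ> \<beta> (inv (\<alpha> u) a) = \<beta> a \<circ> lam rT (inv (\<beta> a) u)"
    using assms unfolding matched_product_system_def by blast+
  show ?thesis
    unfolding s5 s6 by (auto simp: fun_eq_iff lam_def matched_product_def Let_def)
qed

text \<open>
  The outer twists of \<open>\<rho>\<close> depend on its two arguments only through the first output
  \<open>(a, u)\<close>. Naming that output exhibits them as the inverses of the twists in
  \<open>lam_matched_product\<close>.
\<close>

lemma rho_matched_product:
  assumes "lam (matched_product rS rT \<alpha> \<beta>) (b, v) (c, w) = (a, u)"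
  shows "rho (matched_product rS rT \<alpha> \<beta>) (c, w) (b, v) =
    (inv (\<alpha> (inv (\<beta> a) u)) (rho rS (\<alpha> (inv (\<beta> b) v) c) b),
     inv (\<beta> (inv (\<alpha> u) a)) (rho rT (\<beta> (inv (\<alpha> v) b) w) v))"
  using assms by (auto simp: lam_def rho_def matched_product_def Let_def)

theorem theorem10:
  fixes rS :: "'s \<times> 's \<Rightarrow> 's \<times> 's"
    and rT :: "'t \<times> 't \<Rightarrow> 't \<times> 't"
    and \<alpha> :: "'t \<Rightarrow> 's \<Rightarrow> 's"
    and \<beta> :: "'s \<Rightarrow> 't \<Rightarrow> 't"
  assumes "matched_product_system rS rT \<alpha> \<beta>"
    and "left_nondegenerate rS"
    and "left_nondegenerate rT"
  shows "left_nondegenerate (matched_product rS rT \<alpha> \<beta>) \<and>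
    (\<forall>a b u v. structure_shelf (matched_product rS rT \<alpha> \<beta>) (a, u) (b, v) =
       (structure_shelf rS a b, structure_shelf rT u v))"
proof -
  let ?r = "matched_product rS rT \<alpha> \<beta>"
  note lam_r = lam_matched_product[OF assms(1)]
  have bij_\<alpha>: "bij (\<alpha> u)" and bij_\<beta>: "bij (\<beta> a)" for a u
    using assms(1) unfolding matched_product_system_def by blast+
  have bij_S: "bij (lam rS a)" and bij_T: "bij (lam rT u)" for a u
    using assms(2,3) unfolding left_nondegenerate_def by blast+
  have bij_r: "bij (lam ?r x)" for x
  proof (cases x)
    case (Pair a u)
    have "bij (lam rS a \<circ> \<alpha> (inv (\<beta> a) u))" and "bij (lam rT u \<circ> \<beta> (inv (\<alpha> u) a))"
      by (intro bij_comp bij_\<alpha> bij_\<beta> bij_S bij_T)+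
    then have "bij_betw (lam ?r (a, u)) (UNIV \<times> UNIV) (UNIV \<times> UNIV)"
      unfolding lam_r by (rule bij_betw_map_prod)
    then show ?thesis using Pair by simp
  qed
  have "structure_shelf ?r (a, u) (b, v) = (structure_shelf rS a b, structure_shelf rT u v)"
    for a b u v
  proof -
    obtain c w where cw: "inv (lam ?r (b, v)) (a, u) = (c, w)" by fastforce
    then have out: "lam ?r (b, v) (c, w) = (a, u)"
      using bij_r by (metis bij_inv_eq_iff)
    then have "lam rS b (\<alpha> (inv (\<beta> b) v) c) = a" and "lam rT v (\<beta> (inv (\<alpha> v) b) w) = u"
      by (simp_all add: lam_r)
    then have index: "\<alpha> (inv (\<beta> b) v) c = inv (lam rS b) a"
        "\<beta> (inv (\<alpha> v) b) w = inv (lam rT v) u"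
      using bij_S bij_T by (metis bij_inv_eq_iff)+
    have "structure_shelf ?r (a, u) (b, v) = lam ?r (a, u) (rho ?r (c, w) (b, v))"
      by (simp add: structure_shelf_def cw)
    also have "\<dots> = (structure_shelf rS a b, structure_shelf rT u v)"
      unfolding rho_matched_product[OF out] index
      by (simp add: lam_r structure_shelf_def bij_\<alpha> bij_\<beta> bij_is_surj surj_f_inv_f)
    finally show ?thesis .
  qed
  then show ?thesis
    using bij_r unfolding left_nondegenerate_def by blast
qed

end
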